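(* Suppose the standing assumption on $E$, $x^*$, $x^{(0)}$ (with constants $\delta, M, \mu, L$) and the eigenvector accuracy condition $\|V_k^{(n)}{V_k^{(n)}}^\top-\hat V_k^{(n)}{\hat V_k^{(n)}}^\top\|_2\le\alpha$ for all $n\ge 0$ hold, as stated in the context. Let $\kappa=L/\mu$ and suppose $\alpha$ satisfies $$1-\alpha>\kappa\alpha(\alpha+5).$$ Let $\eta=1-\alpha-\kappa\alpha(\alpha+5)>0$ and $\hat r=\frac{2\mu\eta}{M}$, and suppose that the initial point satisfies $$r_0=\|x^{(0)}-x^*\|_2<\min\{\delta,\hat r\},$$ and that $\beta_n=\frac{2}{L(1-\alpha^2)+\mu(1-\alpha)}$ for all $n\ge 0$. Then the iterates $$x^{(n+1)}=x^{(n)}-\beta_n\big(I-2\hat V_k^{(n)}{\hat V_k^{(n)}}^\top\big)\nabla E(x^{(n)})$$ converge to $x^*$ as $n\to\infty$, with $$r_n=\|x^{(n)}-x^*\|_2\le\left(1-\frac{2\eta}{\kappa(1-\alpha^2)+1-\alpha+2\eta}\right)^n\frac{\hat r r_0}{\hat r-r_0}\qquad\text{for all } n\ge 0.$$ In particular, if $\alpha=0$, the convergence factor $1-\frac{2\eta}{\kappa(1-\alpha^2)+1-\alpha+2\eta}$ equals $1-\frac{2}{\kappa+3}$ and the bound reads $r_n\le\left(1-\frac{2}{\kappa+3}\right)^n\frac{\hat r r_0}{\hat r-r_0}$ with $\hat r=\frac{2\mu}{M}$.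
   Context: $E:\mathbb{R}^d\to\mathbb{R}$ is a twice differentiable function, $k$ is an integer with $1\le k\le d$, and $x^*$ is a non-degenerate index-$k$ saddle point of $E$: $\nabla E(x^* )=0$ and the Hessian $\nabla^2E(x^* )$ has exactly $k$ negative eigenvalues and no zero eigenvalue. $\|\cdot\|_2$ denotes the Euclidean norm on vectors and the induced operator norm on matrices. Standing assumption: there is $\delta>0$ such that, with $U(x^*,\delta)=\{x:\|x-x^*\|_2<\delta\}$, the initial point satisfies $x^{(0)}\in U(x^*,\delta)$ and: (i) there is a constant $M>0$ with $\|\nabla^2E(x)-\nabla^2E(y)\|_2\le M\|x-y\|_2$ for all $x,y\in U(x^*,\delta)$; (ii) there are constants $0<\mu<L$ such that for every $x\in U(x^*,\delta)$ the eigenvalues of $\nabla^2E(x)$ satisfy $\lambda_1\le\cdots\le\lambda_k<0<\lambda_{k+1}\le\cdots\le\lambda_d$ and $|\lambda_i|\in[\mu,L]$ for $1\le i\le d$. For each iterate $x^{(n)}$, let $\lambda_1^{(n)}\le\cdots\le\lambda_d^{(n)}$ be the eigenvalues of $\nabla^2E(x^{(n)})$ with corresponding orthonormal eigenvectors $v_1^{(n)},\dots,v_d^{(n)}$, and let $V_k^{(n)}=[v_1^{(n)},\dots,v_k^{(n)}]\in\mathbb{R}^{d\times k}$. Let $\hat v_1^{(n)},\dots,\hat v_k^{(n)}\in\mathbb{R}^d$ be orthonormal vectors (approximate eigenvectors) and $\hat V_k^{(n)}=[\hat v_1^{(n)},\dots,\hat v_k^{(n)}]$. Accuracy condition: $\alpha\in[0,1]$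 is such that $\|V_k^{(n)}{V_k^{(n)}}^\top-\hat V_k^{(n)}{\hat V_k^{(n)}}^\top\|_2\le\alpha$ for every $n\ge 0$. *)

theory Defs
  imports "HOL-Analysis.Analysis" "HOL-Computational_Algebra.Polynomial" "HOL-Library.Multiset"
begin

definition grad :: "(real^'d \<Rightarrow> real) \<Rightarrow> real^'d \<Rightarrow> real^'d" where
  "grad E x = (\<chi> i. frechet_derivative E (at x) (axis i 1))"

definition hessian :: "(real^'d \<Rightarrow> real) \<Rightarrow> real^'d \<Rightarrow> real^'d^'d" where
  "hessian E x = jacobian (grad E) (at x)"

definition twice_differentiable :: "(real^'d \<Rightarrow> real) \<Rightarrow> bool" where
  "twice_differentiable E \<longleftrightarrow>
     (\<forall>x. E differentiable (at x)) \<and> (\<forall>x. grad E differentiable (at x))"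

definition opnorm :: "real^'d^'d \<Rightarrow> real" where
  "opnorm A = onorm (\<lambda>v. A *v v)"

definition charpoly :: "real^'d^'d \<Rightarrow> real poly" where
  "charpoly A = det (mat [:0, 1:] - (\<chi> i j. [:A $ i $ j:]))"

(* Real eigenvalues in increasing order, repeated according to their algebraic
   multiplicity.  For symmetric A (the only use below) the list has length CARD('d). *)
definition eigvals :: "real^'d^'d \<Rightarrow> real list" where
  "eigvals A = sorted_list_of_multiset (proots (charpoly A))"

(* The i-th smallest eigenvalue, with i = 1, ..., CARD('d): indices start at 1. *)
definition eigval :: "real^'d^'d \<Rightarrow> nat \<Rightarrow> real" where
  "eigval A i = eigvals A ! (i - 1)"

definition nondegenerate_saddle :: "(real^'d \<Rightarrow> real) \<Rightarrow> nat \<Rightarrow> real^'d \<Rightarrow> bool" where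
  "nondegenerate_saddle E k x \<longleftrightarrow>
     grad E x = 0 \<and>
     length (filter (\<lambda>l. l < 0) (eigvals (hessian E x))) = k \<and>
     0 \<notin> set (eigvals (hessian E x))"

definition orthonormal_upto :: "nat \<Rightarrow> (nat \<Rightarrow> real^'d) \<Rightarrow> bool" where
  "orthonormal_upto m v \<longleftrightarrow>
     (\<forall>i\<in>{1..m}. \<forall>j\<in>{1..m}. v i \<bullet> v j = (if i = j then 1 else 0))"

(* The d x d matrix V V^T, where V is the d x k matrix with columns v 1, ..., v k
   (k is a natural number, so V itself has no type). *)
definition VVT :: "nat \<Rightarrow> (nat \<Rightarrow> real^'d) \<Rightarrow> real^'d^'d" where
  "VVT k v = (\<chi> a b. \<Sum>i=1..k. v i $ a * v i $ b)"

end

theory Submission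
  imports Defs
begin

text \<open>
  The exact reflection \<open>R = I - 2 V V\<^sup>T\<close> flips the signs of the negative eigenvalues of the Hessian
  \<open>H\<close>, so \<open>R H\<close> has the eigenvalues \<open>\<bar>\<lambda>\<^sub>i\<bar> \<in> [\<mu>, L]\<close> and the saddle search looks locally like gradient
  descent at a minimum. Replacing \<open>V\<close> by the approximate eigenvectors changes \<open>R H\<close> by at most
  \<open>2 \<alpha> L\<close> in operator norm (lemma \<open>norm_reflected_step_le\<close>). Since \<open>\<nabla>E(x*) = 0\<close>, the gradient at \<open>x\<close>
  differs from \<open>H(x) (x - x*)\<close> by at most \<open>M/2 \<parallel>x - x*\<parallel>\<^sup>2\<close> (lemma \<open>lipschitz_derivative_remainder\<close>),
  and the approximate reflection is an isometry (lemma \<open>norm_reflection\<close>), so it does not enlarge this error.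

  With the given step size the two bounds combine to the scalar recursion
  \<open>r\<^sub>n\<^sub>+\<^sub>1 \<le> (1 - q + q r\<^sub>n / rhat) r\<^sub>n\<close>, where \<open>q = \<beta> \<mu> \<eta>\<close>. Below \<open>rhat\<close> this is a contraction, but its
  factor depends on \<open>r\<^sub>n\<close>. The quantity \<open>r / (rhat - r)\<close> removes this dependence: each step multiplies it
  by at most \<open>1 / (1 + q)\<close>, which is exactly the claimed factor (lemma \<open>quadratic_recursion_step\<close>). Since
  \<open>r \<le> rhat r / (rhat - r)\<close>, the claimed bound follows.
\<close>

section \<open>Orthonormal families\<close>

lemma norm_orthonormal_sum:
  fixes v :: "nat \<Rightarrow> real^'d"
  assumes "orthonormal_upto m v"
  shows "(norm (\<Sum>i=1..m. c i *\<^sub>R v i))\<^sup>2 = (\<Sum>i=1..m. (c i)\<^sup>2)"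
proof -
  have inner: "v i \<bullet> v j = (if i = j then 1 else 0)" if "i \<in> {1..m}" "j \<in> {1..m}" for i j
    using assms that by (simp add: orthonormal_upto_def)
  have "(norm (\<Sum>i=1..m. c i *\<^sub>R v i))\<^sup>2 = (\<Sum>i=1..m. \<Sum>j=1..m. c i * (c j * (v j \<bullet> v i)))"
    by (simp add: power2_norm_eq_inner inner_sum_left inner_sum_right sum_distrib_left)
  also have "\<dots> = (\<Sum>i=1..m. \<Sum>j=1..m. if i = j then (c i)\<^sup>2 else 0)"
    by (intro sum.cong refl) (simp only: inner, auto simp: power2_eq_square)
  also have "\<dots> = (\<Sum>i=1..m. (c i)\<^sup>2)"
    by (intro sum.cong refl) (simp add: sum.delta)
  finally show ?thesis .
qed

lemma orthonormal_expansion: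
  fixes v :: "nat \<Rightarrow> real^'d"
  assumes "orthonormal_upto CARD('d) v"
  shows "(\<Sum>i=1..CARD('d). (w \<bullet> v i) *\<^sub>R v i) = w"
proof -
  let ?I = "{1..CARD('d)}" and ?B = "v ` {1..CARD('d)}"
  have inner: "v i \<bullet> v j = (if i = j then 1 else 0)" if "i \<in> ?I" "j \<in> ?I" for i j
    using assms that by (simp add: orthonormal_upto_def)
  have norm1: "norm b = 1" if "b \<in> ?B" for b
    using that inner by (auto simp: norm_eq_1)
  have inj: "inj_on v ?I"
    by (rule inj_onI) (metis inner zero_neq_one)
  have orth: "pairwise orthogonal ?B"
    unfolding pairwise_def orthogonal_def using inner by auto
  have "0 \<notin> ?B"
    using norm1 by force
  then have indep: "independent ?B"
    by (rule pairwise_orthogonal_independent[OF orth])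
  have "card ?B = CARD('d)"
    using inj by (simp add: card_image)
  then have "UNIV \<subseteq> span ?B"
    using indep by (intro card_ge_dim_independent) auto
  then have "(\<Sum>b\<in>?B. (w \<bullet> b) *\<^sub>R b) = w"
    using orth norm1 by (intro orthonormal_basis_expand) auto
  then show ?thesis
    using inj by (simp add: sum.reindex)
qed

lemma norm_square_orthonormal_coeffs:
  fixes v :: "nat \<Rightarrow> real^'d"
  assumes "orthonormal_upto CARD('d) v"
  shows "(norm w)\<^sup>2 = (\<Sum>i=1..CARD('d). (w \<bullet> v i)\<^sup>2)"
  using norm_orthonormal_sum[OF assms, of "\<lambda>i. w \<bullet> v i"] orthonormal_expansion[OF assms, of w]
  by simp

text \<open>A linear map that is diagonal in an orthonormal basis, with entries \<open>a\<^sub>i\<close>, has operator norm at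
  most \<open>max \<bar>a\<^sub>i\<bar>\<close>, because both norms are sums of squares of coefficients.\<close>

lemma norm_diagonal_le:
  fixes v :: "nat \<Rightarrow> real^'d"
  assumes v: "orthonormal_upto CARD('d) v"
    and a: "\<And>i. i \<in> {1..CARD('d)} \<Longrightarrow> \<bar>a i\<bar> \<le> C"
  shows "norm (\<Sum>i=1..CARD('d). (a i * (w \<bullet> v i)) *\<^sub>R v i) \<le> C * norm w"
proof -
  have "1 \<in> {1..CARD('d)}"
    using zero_less_card_finite[where 'a='d] by (simp add: Suc_le_eq)
  then have C: "0 \<le> C"
    using a[of 1] by linarith
  have "(norm (\<Sum>i=1..CARD('d). (a i * (w \<bullet> v i)) *\<^sub>R v i))\<^sup>2
      = (\<Sum>i=1..CARD('d). (a i)\<^sup>2 * (w \<bullet> v i)\<^sup>2)"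
    using norm_orthonormal_sum[OF v, of "\<lambda>i. a i * (w \<bullet> v i)"] by (simp add: power_mult_distrib)
  also have "\<dots> \<le> (\<Sum>i=1..CARD('d). C\<^sup>2 * (w \<bullet> v i)\<^sup>2)"
    by (intro sum_mono mult_right_mono) (use a C in \<open>auto simp: abs_le_square_iff[symmetric]\<close>)
  also have "\<dots> = (C * norm w)\<^sup>2"
    unfolding power_mult_distrib norm_square_orthonormal_coeffs[OF v] by (simp add: sum_distrib_left)
  finally show ?thesis
    by (rule power2_le_imp_le) (use C in simp)
qed

lemma VVT_mult_vec: "VVT k v *v u = (\<Sum>i=1..k. (u \<bullet> v i) *\<^sub>R v i)"
proof (rule iffD2[OF vec_eq_iff], rule allI)
  fix a
  have "(VVT k v *v u) $ a = (\<Sum>b\<in>UNIV. \<Sum>i=1..k. v i $ a * v i $ b * u $ b)"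
    by (simp add: VVT_def matrix_vector_mult_def sum_distrib_right)
  also have "\<dots> = (\<Sum>i=1..k. \<Sum>b\<in>UNIV. v i $ a * v i $ b * u $ b)"
    by (rule sum.swap)
  also have "\<dots> = (\<Sum>i=1..k. (u \<bullet> v i) *\<^sub>R v i) $ a"
    by (simp add: inner_vec_def sum_distrib_left sum_distrib_right mult_ac)
  finally show "(VVT k v *v u) $ a = (\<Sum>i=1..k. (u \<bullet> v i) *\<^sub>R v i) $ a" .
qed

lemma reflection_mult_vec:
  fixes P :: "real^'d^'d"
  shows "(mat 1 - 2 *\<^sub>R P) *v u = u - 2 *\<^sub>R (P *v u)"
  by (simp add: matrix_vector_mult_diff_rdistrib scaleR_matrix_vector_assoc)

text \<open>The vector \<open>p = V V\<^sup>T u\<close> satisfies \<open>u \<bullet> p = \<parallel>p\<parallel>\<^sup>2\<close>, so expanding \<open>\<parallel>u - 2 p\<parallel>\<^sup>2\<close> leaves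
  \<open>\<parallel>u\<parallel>\<^sup>2\<close>.\<close>

lemma norm_reflection:
  fixes u :: "real^'d"
  assumes "orthonormal_upto k v"
  shows "norm ((mat 1 - 2 *\<^sub>R VVT k v) *v u) = norm u"
proof -
  let ?p = "VVT k v *v u"
  have "u \<bullet> ?p = (\<Sum>i=1..k. (u \<bullet> v i)\<^sup>2)"
    by (simp add: VVT_mult_vec inner_sum_right power2_eq_square)
  also have "\<dots> = ?p \<bullet> ?p"
    using norm_orthonormal_sum[OF assms, of "\<lambda>i. u \<bullet> v i"]
    by (simp add: VVT_mult_vec power2_norm_eq_inner)
  finally have "(norm (u - 2 *\<^sub>R ?p))\<^sup>2 = (norm u)\<^sup>2"
    unfolding power2_norm_eq_inner by (simp add: inner_diff_left inner_diff_right inner_commute)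
  then show ?thesis
    by (simp add: reflection_mult_vec)
qed

lemma norm_mult_vec_le_opnorm: "norm (A *v w) \<le> opnorm A * norm w"
  unfolding opnorm_def by (rule onorm) (rule matrix_vector_mul_bounded_linear)

section \<open>The linearised step\<close>

text \<open>
  In the eigenbasis of \<open>H\<close>, the step with the exact reflection is diagonal with entries
  \<open>1 - \<beta> \<bar>\<lambda>\<^sub>i\<bar>\<close>, whose moduli are maximal at the ends of \<open>[\<mu>, L]\<close>. The error \<open>V V\<^sup>T - P\<close> of the
  projection enters only through \<open>2 \<beta> (V V\<^sup>T - P) H\<close>.
\<close>

lemma norm_reflected_step_le:
  fixes H P :: "real^'d^'d" and v :: "nat \<Rightarrow> real^'d"
  assumes v: "orthonormal_upto CARD('d) v"
    and k: "k \<le> CARD('d)"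
    and eig: "\<And>i. i \<in> {1..CARD('d)} \<Longrightarrow> H *v v i = l i *\<^sub>R v i"
    and neg: "\<And>i. i \<in> {1..k} \<Longrightarrow> l i < 0"
    and pos: "\<And>i. i \<in> {k+1..CARD('d)} \<Longrightarrow> 0 < l i"
    and bounds: "\<And>i. i \<in> {1..CARD('d)} \<Longrightarrow> \<bar>l i\<bar> \<in> {\<mu>..L}"
    and P: "opnorm (VVT k v - P) \<le> \<alpha>"
    and nonneg: "0 \<le> \<beta>" "0 \<le> \<alpha>"
  shows "norm (w - \<beta> *\<^sub>R ((mat 1 - 2 *\<^sub>R P) *v (H *v w)))
    \<le> (max (1 - \<beta> * \<mu>) (\<beta> * L - 1) + 2 * \<beta> * \<alpha> * L) * norm w"
proof -
  let ?I = "{1..CARD('d)}" and ?V = "VVT k v"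
  have inner: "v i \<bullet> v j = (if i = j then 1 else 0)" if "i \<in> ?I" "j \<in> ?I" for i j
    using v that by (simp add: orthonormal_upto_def)
  have "H *v w = H *v (\<Sum>i\<in>?I. (w \<bullet> v i) *\<^sub>R v i)"
    by (simp only: orthonormal_expansion[OF v])
  also have "\<dots> = (\<Sum>i\<in>?I. H *v ((w \<bullet> v i) *\<^sub>R v i))"
    by (rule linear_sum) simp
  also have "\<dots> = (\<Sum>i\<in>?I. (l i * (w \<bullet> v i)) *\<^sub>R v i)"
    by (intro sum.cong refl) (simp add: matrix_vector_mult_scaleR eig mult.commute)
  finally have Hw: "H *v w = (\<Sum>i\<in>?I. (l i * (w \<bullet> v i)) *\<^sub>R v i)" .
  have coeff: "(H *v w) \<bullet> v i = l i * (w \<bullet> v i)" if i: "i \<in> ?I" for i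
  proof -
    have "(H *v w) \<bullet> v i = (\<Sum>j\<in>?I. if j = i then l j * (w \<bullet> v j) else 0)"
      unfolding Hw inner_sum_left by (intro sum.cong refl) (use i inner in auto)
    then show ?thesis
      using i by (simp add: sum.delta)
  qed
  have "?V *v (H *v w) = (\<Sum>i=1..k. (l i * (w \<bullet> v i)) *\<^sub>R v i)"
    unfolding VVT_mult_vec using k by (intro sum.cong refl) (simp add: coeff)
  also have "\<dots> = (\<Sum>i\<in>?I. if i \<le> k then (l i * (w \<bullet> v i)) *\<^sub>R v i else 0)"
    using k by (intro sum.mono_neutral_cong_left) auto
  finally have VHw: "?V *v (H *v w) = (\<Sum>i\<in>?I. if i \<le> k then (l i * (w \<bullet> v i)) *\<^sub>R v i else 0)" .
  have "w - \<beta> *\<^sub>R (H *v w - 2 *\<^sub>R (?V *v (H *v w)))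
      = (\<Sum>i\<in>?I. (w \<bullet> v i) *\<^sub>R v i) - \<beta> *\<^sub>R (H *v w - 2 *\<^sub>R (?V *v (H *v w)))"
    by (simp only: orthonormal_expansion[OF v])
  also have "\<dots> = (\<Sum>i\<in>?I. ((1 - \<beta> * \<bar>l i\<bar>) * (w \<bullet> v i)) *\<^sub>R v i)"
    unfolding VHw unfolding Hw scaleR_sum_right sum_subtractf[symmetric]
  proof (intro sum.cong refl)
    fix i assume i: "i \<in> ?I"
    show "(w \<bullet> v i) *\<^sub>R v i - \<beta> *\<^sub>R ((l i * (w \<bullet> v i)) *\<^sub>R v i
          - 2 *\<^sub>R (if i \<le> k then (l i * (w \<bullet> v i)) *\<^sub>R v i else 0))
        = ((1 - \<beta> * \<bar>l i\<bar>) * (w \<bullet> v i)) *\<^sub>R v i"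
    proof (cases "i \<le> k")
      case True
      then have "\<bar>l i\<bar> = - l i" using neg[of i] i by simp
      then show ?thesis using True by (simp add: vec_eq_iff algebra_simps)
    next
      case False
      then have "\<bar>l i\<bar> = l i" using pos[of i] i by simp
      then show ?thesis using False by (simp add: algebra_simps)
    qed
  qed
  finally have exact: "w - \<beta> *\<^sub>R (H *v w - 2 *\<^sub>R (?V *v (H *v w)))
      = (\<Sum>i\<in>?I. ((1 - \<beta> * \<bar>l i\<bar>) * (w \<bullet> v i)) *\<^sub>R v i)" .
  have "\<bar>1 - \<beta> * \<bar>l i\<bar>\<bar> \<le> max (1 - \<beta> * \<mu>) (\<beta> * L - 1)" if "i \<in> ?I" for i
  proof -
    have "\<beta> * \<mu> \<le> \<beta> * \<bar>l i\<bar>" "\<beta> * \<bar>l i\<bar> \<le> \<beta> * L"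
      using bounds[OF that] nonneg by (auto intro: mult_left_mono)
    then show ?thesis by linarith
  qed
  then have first: "norm (w - \<beta> *\<^sub>R (H *v w - 2 *\<^sub>R (?V *v (H *v w))))
      \<le> max (1 - \<beta> * \<mu>) (\<beta> * L - 1) * norm w"
    unfolding exact by (rule norm_diagonal_le[OF v])
  have "norm (H *v w) \<le> L * norm w"
    unfolding Hw by (rule norm_diagonal_le[OF v]) (use bounds in auto)
  then have second: "norm ((?V - P) *v (H *v w)) \<le> \<alpha> * (L * norm w)"
    using norm_mult_vec_le_opnorm[of "?V - P" "H *v w"] mult_mono[OF P, of "norm (H *v w)" "L * norm w"]
      nonneg by auto
  have "w - \<beta> *\<^sub>R ((mat 1 - 2 *\<^sub>R P) *v (H *v w))
      = (w - \<beta> *\<^sub>R (H *v w - 2 *\<^sub>R (?V *v (H *v w)))) - (2 * \<beta>) *\<^sub>R ((?V - P) *v (H *v w))"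
    unfolding reflection_mult_vec by (simp add: matrix_vector_mult_diff_rdistrib algebra_simps)
  also have "norm \<dots> \<le> norm (w - \<beta> *\<^sub>R (H *v w - 2 *\<^sub>R (?V *v (H *v w))))
      + 2 * \<beta> * norm ((?V - P) *v (H *v w))"
    using norm_triangle_ineq4[of "w - \<beta> *\<^sub>R (H *v w - 2 *\<^sub>R (?V *v (H *v w)))"
        "(2 * \<beta>) *\<^sub>R ((?V - P) *v (H *v w))"] nonneg by simp
  also have "\<dots> \<le> max (1 - \<beta> * \<mu>) (\<beta> * L - 1) * norm w + 2 * \<beta> * (\<alpha> * (L * norm w))"
    using first second nonneg by (intro add_mono mult_left_mono) auto
  finally show ?thesis
    by (simp add: algebra_simps)
qed

section \<open>The linearisation error\<close>

text \<open>
  With \<open>h = x - a\<close>, the \<open>t\<close>-derivative of \<open>g (a + t h) - t J(x) h\<close> has norm at most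
  \<open>M (1 - t) \<parallel>h\<parallel>\<^sup>2\<close>, because \<open>a + t h\<close> has distance \<open>(1 - t) \<parallel>h\<parallel>\<close> from \<open>x\<close>. The mean value
  inequality compares it with the antiderivative of this bound, which grows by
  \<open>M/2 \<parallel>h\<parallel>\<^sup>2\<close> on \<open>[0, 1]\<close>.
\<close>

lemma lipschitz_derivative_remainder:
  fixes g :: "real^'d \<Rightarrow> real^'d" and J :: "real^'d \<Rightarrow> real^'d^'d"
  assumes deriv: "\<And>y. y \<in> ball a \<delta> \<Longrightarrow> (g has_derivative (\<lambda>h. J y *v h)) (at y)"
    and lip: "\<And>y z. y \<in> ball a \<delta> \<Longrightarrow> z \<in> ball a \<delta> \<Longrightarrow> opnorm (J y - J z) \<le> M * norm (y - z)"
    and x: "x \<in> ball a \<delta>"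
  shows "norm (g x - g a - J x *v (x - a)) \<le> M / 2 * (norm (x - a))\<^sup>2"
proof -
  define h where "h = x - a"
  define f where "f t = g (a + t *\<^sub>R h) - t *\<^sub>R (J x *v h)" for t :: real
  define f' where "f' t = J (a + t *\<^sub>R h) *v h - J x *v h" for t :: real
  define p where "p t = M * (norm h)\<^sup>2 * (t - t\<^sup>2 / 2)" for t :: real
  define p' where "p' t = M * (norm h)\<^sup>2 * (1 - t)" for t :: real
  have seg: "a + t *\<^sub>R h \<in> ball a \<delta>" if "t \<in> {0..1}" for t
  proof -
    have "norm (t *\<^sub>R h) \<le> norm h"
      using that by (simp add: mult_left_le_one_le)
    also have "\<dots> < \<delta>"
      using x by (simp add: h_def dist_norm norm_minus_commute)
    finally show ?thesis by (simp add: dist_norm)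
  qed
  have f_deriv: "(f has_vector_derivative f' t) (at t)" if "t \<in> {0..1}" for t
  proof -
    have line: "((\<lambda>t. a + t *\<^sub>R h) has_derivative (\<lambda>s. s *\<^sub>R h)) (at t)"
      by (auto intro!: derivative_eq_intros)
    have "(g \<circ> (\<lambda>t. a + t *\<^sub>R h) has_derivative (\<lambda>y. J (a + t *\<^sub>R h) *v y) \<circ> (\<lambda>s. s *\<^sub>R h)) (at t)"
      using line deriv[OF seg[OF that]] by (rule diff_chain_at)
    then have "((\<lambda>t. g (a + t *\<^sub>R h)) has_vector_derivative J (a + t *\<^sub>R h) *v h) (at t)"
      by (simp add: has_vector_derivative_def o_def matrix_vector_mult_scaleR)
    then show ?thesis
      unfolding f_def f'_def by (auto intro!: derivative_eq_intros)
  qed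
  have p_deriv: "(p has_vector_derivative p' t) (at t)" for t
    unfolding p_def p'_def has_real_derivative_iff_has_vector_derivative[symmetric]
    by (auto intro!: derivative_eq_intros)
  have bound: "norm (f' t) \<le> p' t" if t: "t \<in> {0..1}" for t
  proof -
    have "norm (f' t) \<le> opnorm (J (a + t *\<^sub>R h) - J x) * norm h"
      unfolding f'_def using norm_mult_vec_le_opnorm[of "J (a + t *\<^sub>R h) - J x" h]
      by (simp add: matrix_vector_mult_diff_rdistrib)
    also have "\<dots> \<le> M * norm (a + t *\<^sub>R h - x) * norm h"
      using lip[OF seg[OF t] x] by (intro mult_right_mono) auto
    also have "a + t *\<^sub>R h - x = - ((1 - t) *\<^sub>R h)"
      by (simp add: h_def algebra_simps)
    also have "M * norm (- ((1 - t) *\<^sub>R h)) * norm h = p' t"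
      using t by (simp add: p'_def power2_eq_square)
    finally show ?thesis .
  qed
  have "norm (f 1 - f 0) \<le> p 1 - p 0"
  proof (rule differentiable_bound_general)
    show "continuous_on {0..1} f" "continuous_on {0..1} p"
      using f_deriv p_deriv
      by (blast intro: continuous_at_imp_continuous_on has_vector_derivative_continuous)+
    show "(f has_vector_derivative f' t) (at t)" if "0 < t" "t < 1" for t
      using f_deriv that by simp
  qed (use p_deriv bound in auto)
  then show ?thesis
    by (simp add: f_def p_def h_def algebra_simps)
qed

lemma grad_has_derivative_hessian:
  assumes "twice_differentiable E"
  shows "(grad E has_derivative (\<lambda>h. hessian E y *v h)) (at y)"
  using assms jacobian_works[of "grad E" "at y"]
  by (simp add: twice_differentiable_def hessian_def)

section \<open>The scalar recursion\<close>

text \<open>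
  Put \<open>s = q (1 - r/R)\<close>. Then \<open>r' \<le> (1 - s) r \<le> r / (1 + s)\<close>, and \<open>t / (R - t)\<close> is increasing on
  \<open>[0, R)\<close>. At \<open>t = r / (1 + s)\<close> it equals \<open>r / (R (1 + s) - r) = r / ((1 + q) (R - r))\<close>.
\<close>

lemma quadratic_recursion_step:
  fixes q r r' R :: real
  assumes q: "0 \<le> q" and r: "0 \<le> r" "r < R" and r': "r' \<le> (1 - q + q * r / R) * r"
  shows "r' \<le> r" and "r' / (R - r') \<le> 1 / (1 + q) * (r / (R - r))"
proof -
  define s where "s = q * (1 - r / R)"
  have s: "0 \<le> s" and r's: "r' \<le> (1 - s) * r"
    using assms mult_left_mono[of "r / R" 1 q] by (auto simp: s_def algebra_simps)
  have "(1 - s) * r \<le> 1 * r"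
    using s r by (intro mult_right_mono) auto
  with r's show le: "r' \<le> r" by simp
  have "r' * (1 + s) \<le> (1 - s) * r * (1 + s)"
    using r's s by (intro mult_right_mono) auto
  also have "\<dots> = r - s\<^sup>2 * r"
    by (simp add: algebra_simps power2_eq_square)
  finally have "r' * (1 + s) \<le> r"
    using r by (smt (verit) mult_nonneg_nonneg zero_le_power2)
  then have "R * (r' * (1 + s)) \<le> R * r"
    using r by (intro mult_left_mono) auto
  moreover have "R * s = q * (R - r)"
    using r by (simp add: s_def field_simps)
  then have "R * (r' * (1 + s)) = r' * (R + q * (R - r))"
    by algebra
  ultimately have "r' * (R + q * (R - r)) \<le> R * r"
    by simp
  then have "r' * ((1 + q) * (R - r)) \<le> r * (R - r')"
    by (simp add: algebra_simps)
  then show "r' / (R - r') \<le> 1 / (1 + q) * (r / (R - r))"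
    using q r le by (simp add: pos_divide_le_eq pos_le_divide_eq mult_ac)
qed

theorem theorem5p5:
  fixes E :: "real^'d \<Rightarrow> real"
    and k :: nat
    and xs :: "real^'d"
    and x :: "nat \<Rightarrow> real^'d"
    and v vh :: "nat \<Rightarrow> nat \<Rightarrow> real^'d"
    and \<beta> :: "nat \<Rightarrow> real"
    and \<delta> M \<mu> L \<alpha> \<kappa> \<eta> rhat r0 :: real
  assumes twice_diff: "twice_differentiable E"
    and k_range: "1 \<le> k" "k \<le> CARD('d)"
    and saddle: "nondegenerate_saddle E k xs"
    and delta_pos: "0 < \<delta>"
    and init: "x 0 \<in> ball xs \<delta>"
    and M_pos: "0 < M"
    and hess_lipschitz:
      "\<forall>y\<in>ball xs \<delta>. \<forall>z\<in>ball xs \<delta>. opnorm (hessian E y - hessian E z) \<le> M * norm (y - z)"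
    and mu_L: "0 < \<mu>" "\<mu> < L"
    and hess_eigvals:
      "\<forall>y\<in>ball xs \<delta>.
         (\<forall>i\<in>{1..k}. eigval (hessian E y) i < 0) \<and>
         (\<forall>i\<in>{k+1..CARD('d)}. 0 < eigval (hessian E y) i) \<and>
         (\<forall>i\<in>{1..CARD('d)}. \<bar>eigval (hessian E y) i\<bar> \<in> {\<mu>..L})"
    and eigvecs_orthonormal: "\<forall>n. orthonormal_upto CARD('d) (v n)"
    and eigvecs:
      "\<forall>n. \<forall>i\<in>{1..CARD('d)}. hessian E (x n) *v v n i = eigval (hessian E (x n)) i *\<^sub>R v n i"
    and approx_orthonormal: "\<forall>n. orthonormal_upto k (vh n)"
    and alpha_range: "\<alpha> \<in> {0..1}"
    and accuracy: "\<forall>n. opnorm (VVT k (v n) - VVT k (vh n)) \<le> \<alpha>"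
    and kappa: "\<kappa> = L / \<mu>"
    and alpha_small: "1 - \<alpha> > \<kappa> * \<alpha> * (\<alpha> + 5)"
    and eta: "\<eta> = 1 - \<alpha> - \<kappa> * \<alpha> * (\<alpha> + 5)"
    and rhat: "rhat = 2 * \<mu> * \<eta> / M"
    and r0: "r0 = norm (x 0 - xs)" "r0 < min \<delta> rhat"
    and step_size: "\<forall>n. \<beta> n = 2 / (L * (1 - \<alpha>^2) + \<mu> * (1 - \<alpha>))"
    and iteration:
      "\<forall>n. x (Suc n) = x n - \<beta> n *\<^sub>R ((mat 1 - 2 *\<^sub>R VVT k (vh n)) *v grad E (x n))"
  shows "x \<longlonglongrightarrow> xs
    \<and> (\<forall>n. norm (x n - xs)
          \<le> (1 - 2 * \<eta> / (\<kappa> * (1 - \<alpha>^2) + 1 - \<alpha> + 2 * \<eta>)) ^ n * (rhat * r0 / (rhat - r0)))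
    \<and> (\<alpha> = 0 \<longrightarrow>
         1 - 2 * \<eta> / (\<kappa> * (1 - \<alpha>^2) + 1 - \<alpha> + 2 * \<eta>) = 1 - 2 / (\<kappa> + 3)
         \<and> rhat = 2 * \<mu> / M
         \<and> (\<forall>n. norm (x n - xs) \<le> (1 - 2 / (\<kappa> + 3)) ^ n * (rhat * r0 / (rhat - r0))))"
proof -
  define q where "q = \<beta> 0 * \<mu> * \<eta>"
  define \<theta> where "\<theta> = 1 / (1 + q)"
  define C where "C = rhat * r0 / (rhat - r0)"
  define D where "D = \<kappa> * (1 - \<alpha>\<^sup>2) + 1 - \<alpha>"

  have L: "0 < L" and \<kappa>: "0 < \<kappa>" and L_eq: "L = \<kappa> * \<mu>"
    using mu_L kappa by auto
  have "0 \<le> \<alpha>"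
    using alpha_range by simp
  then have "0 \<le> \<kappa> * \<alpha> * (\<alpha> + 5)"
    using \<kappa> by simp
  with alpha_small \<open>0 \<le> \<alpha>\<close> have \<alpha>: "0 \<le> \<alpha>" "\<alpha> < 1"
    by auto
  have \<alpha>sq: "\<alpha>\<^sup>2 \<le> 1"
    using \<alpha> by (simp add: power_le_one)
  have \<eta>: "0 < \<eta>"
    using alpha_small eta by simp
  have D: "0 < D"
    using \<alpha> \<alpha>sq \<kappa> by (simp add: D_def add_nonneg_pos add_diff_eq[symmetric])
  have step: "\<beta> n = \<beta> 0" for n
    using step_size by simp
  have "L * (1 - \<alpha>\<^sup>2) + \<mu> * (1 - \<alpha>) = \<mu> * D"
    by (simp add: L_eq D_def algebra_simps)
  then have \<beta>_eq: "\<beta> 0 = 2 / (\<mu> * D)"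
    using step_size by simp
  have \<beta>: "0 < \<beta> 0"
    using mu_L D by (simp add: \<beta>_eq)
  have \<beta>2: "\<beta> 0 * L * (1 - \<alpha>\<^sup>2) + \<beta> 0 * \<mu> * (1 - \<alpha>) = 2"
  proof -
    have "\<beta> 0 * (L * (1 - \<alpha>\<^sup>2) + \<mu> * (1 - \<alpha>)) = 2"
      unfolding \<open>L * (1 - \<alpha>\<^sup>2) + \<mu> * (1 - \<alpha>) = \<mu> * D\<close> using mu_L D by (simp add: \<beta>_eq)
    then show ?thesis by (simp only: distrib_left mult.assoc)
  qed
  have q: "0 < q"
    using \<beta> mu_L \<eta> by (simp add: q_def)
  have q_eq: "q = 2 * \<eta> / D"
    using mu_L by (simp add: q_def \<beta>_eq)
  have rate: "1 - 2 * \<eta> / (D + 2 * \<eta>) = \<theta>"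
    using D \<eta> by (simp add: \<theta>_def q_eq field_simps)
  have R: "0 < rhat" "0 \<le> r0" "r0 < rhat" "r0 < \<delta>"
    using r0 mu_L \<eta> M_pos by (auto simp: rhat)

  \<comment> \<open>Substituting \<open>2 = \<beta> L (1 - \<alpha>\<^sup>2) + \<beta> \<mu> (1 - \<alpha>)\<close> turns \<open>\<beta> L - 1\<close> into
    \<open>1 - \<beta> \<mu> (1 - \<alpha>) + \<beta> L \<alpha>\<^sup>2\<close>; adding \<open>2 \<beta> \<alpha> L\<close> stays \<open>3 \<beta> \<alpha> L\<close> below \<open>1 - q\<close>.\<close>
  have factor: "max (1 - \<beta> 0 * \<mu>) (\<beta> 0 * L - 1) + 2 * \<beta> 0 * \<alpha> * L \<le> 1 - q"
  proof -
    have "q = \<beta> 0 * \<mu> * (1 - \<alpha>) - \<beta> 0 * L * (\<alpha> * (\<alpha> + 5))"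
      by (simp add: q_def eta L_eq algebra_simps)
    moreover have "0 \<le> \<beta> 0 * L * \<alpha>" "0 \<le> \<beta> 0 * L * \<alpha>\<^sup>2" "0 \<le> \<beta> 0 * \<mu> * \<alpha>"
      using \<beta> L mu_L \<alpha> by auto
    ultimately show ?thesis
      using \<beta>2 by (simp add: algebra_simps power2_eq_square)
  qed

  have one_step: "norm (x (Suc n) - xs) \<le> (1 - q + q * norm (x n - xs) / rhat) * norm (x n - xs)"
    if near: "norm (x n - xs) < \<delta>" for n
  proof -
    define w where "w = x n - xs"
    let ?H = "hessian E (x n)" and ?R = "mat 1 - 2 *\<^sub>R VVT k (vh n)"
    let ?e = "grad E (x n) - ?H *v w"
    have ball: "x n \<in> ball xs \<delta>"
      using near by (simp add: dist_norm norm_minus_commute)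
    have "norm (grad E (x n) - grad E xs - ?H *v (x n - xs)) \<le> M / 2 * (norm (x n - xs))\<^sup>2"
      by (rule lipschitz_derivative_remainder[where \<delta> = \<delta>])
        (use grad_has_derivative_hessian[OF twice_diff] hess_lipschitz ball in auto)
    then have e: "norm ?e \<le> M / 2 * (norm w)\<^sup>2"
      using saddle by (simp add: nondegenerate_saddle_def w_def)
    have "norm (w - \<beta> 0 *\<^sub>R (?R *v (?H *v w)))
        \<le> (max (1 - \<beta> 0 * \<mu>) (\<beta> 0 * L - 1) + 2 * \<beta> 0 * \<alpha> * L) * norm w"
      by (rule norm_reflected_step_le[where v = "v n" and l = "eigval ?H"])
        (use eigvecs_orthonormal eigvecs hess_eigvals ball k_range accuracy \<alpha> \<beta> in auto)
    also have "\<dots> \<le> (1 - q) * norm w"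
      using factor by (intro mult_right_mono) auto
    finally have lin: "norm (w - \<beta> 0 *\<^sub>R (?R *v (?H *v w))) \<le> (1 - q) * norm w" .
    have "x (Suc n) - xs = (w - \<beta> 0 *\<^sub>R (?R *v (?H *v w))) - \<beta> 0 *\<^sub>R (?R *v ?e)"
      unfolding iteration[rule_format] step[of n]
      by (simp add: w_def matrix_vector_mult_diff_distrib algebra_simps)
    also have "norm \<dots> \<le> norm (w - \<beta> 0 *\<^sub>R (?R *v (?H *v w))) + norm (\<beta> 0 *\<^sub>R (?R *v ?e))"
      by (rule norm_triangle_ineq4)
    also have "norm (\<beta> 0 *\<^sub>R (?R *v ?e)) = \<beta> 0 * norm ?e"
      using \<beta> norm_reflection[of k "vh n" ?e] approx_orthonormal by simp
    also have "norm (w - \<beta> 0 *\<^sub>R (?R *v (?H *v w))) + \<beta> 0 * norm ?e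
        \<le> (1 - q) * norm w + \<beta> 0 * (M / 2 * (norm w)\<^sup>2)"
      using lin e \<beta> by (intro add_mono mult_left_mono) auto
    also have "\<beta> 0 * (M / 2 * (norm w)\<^sup>2) = q * norm w / rhat * norm w"
      using M_pos mu_L \<eta> by (simp add: q_def rhat power2_eq_square)
    finally show ?thesis
      by (simp add: w_def algebra_simps)
  qed

  have inv: "norm (x n - xs) \<le> r0
      \<and> norm (x n - xs) / (rhat - norm (x n - xs)) \<le> \<theta> ^ n * (r0 / (rhat - r0))" for n
  proof (induction n)
    case 0
    then show ?case by (simp add: r0)
  next
    case (Suc n)
    let ?r = "norm (x n - xs)" and ?r' = "norm (x (Suc n) - xs)"
    have r: "?r \<le> r0" and ratio: "?r / (rhat - ?r) \<le> \<theta> ^ n * (r0 / (rhat - r0))"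
      using Suc by auto
    have "?r' \<le> (1 - q + q * ?r / rhat) * ?r"
      using one_step r R by simp
    then have "?r' \<le> ?r" "?r' / (rhat - ?r') \<le> \<theta> * (?r / (rhat - ?r))"
      using quadratic_recursion_step[of q ?r rhat ?r'] q r R unfolding \<theta>_def by auto
    moreover have "\<theta> * (?r / (rhat - ?r)) \<le> \<theta> * (\<theta> ^ n * (r0 / (rhat - r0)))"
      using ratio q by (intro mult_left_mono) (auto simp: \<theta>_def)
    ultimately show ?case
      using r by (auto simp: mult.assoc)
  qed

  have bound: "norm (x n - xs) \<le> \<theta> ^ n * C" for n
  proof -
    let ?r = "norm (x n - xs)"
    have r: "?r < rhat" using inv[of n] R by simp
    have "?r * (rhat - ?r) \<le> ?r * rhat"
      by (intro mult_left_mono) auto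
    then have "?r \<le> rhat * (?r / (rhat - ?r))"
      using r by (simp add: field_simps)
    also have "\<dots> \<le> rhat * (\<theta> ^ n * (r0 / (rhat - r0)))"
      using inv[of n] R by (intro mult_left_mono) auto
    finally show ?thesis by (simp add: C_def mult_ac)
  qed

  have "(\<lambda>n. \<theta> ^ n * C) \<longlonglongrightarrow> 0"
    using q by (intro tendsto_mult_left_zero LIMSEQ_power_zero) (simp add: \<theta>_def)
  then have "(\<lambda>n. x n - xs) \<longlonglongrightarrow> 0"
    by (rule Lim_null_comparison[rotated]) (use bound in auto)
  then have "x \<longlonglongrightarrow> xs"
    by (simp add: LIM_zero_iff)
  moreover have rate': "1 - 2 * \<eta> / (\<kappa> * (1 - \<alpha>^2) + 1 - \<alpha> + 2 * \<eta>) = \<theta>"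
    using rate by (simp add: D_def)
  moreover have "\<theta> = 1 - 2 / (\<kappa> + 3)" "rhat = 2 * \<mu> / M" if "\<alpha> = 0"
    using that rate' by (simp_all add: eta rhat add.commute)
  ultimately show ?thesis
    using bound by (auto simp: C_def)
qed

end
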